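(* Let $f:\mathbb{R}^n\to\mathbb{R}$ be twice differentiable with $L_H$-Lipschitz Hessian, i.e. $\|\nabla^2 f(x)-\nabla^2 f(y)\|\le L_H\|x-y\|$ for all $x,y\in\mathbb{R}^n$ (some $L_H\ge 0$), and suppose $f^\star:=\inf f>-\infty$. Let $M>0$ with $M\ge L_H$, let $x_0\in\mathbb{R}^n$ with $\nabla f(x_0)\neq 0$, and let $x_{k+1}=x_k+s_k^\star$ for $k\ge 0$, where $s_k^\star$ is a global minimizer over $s\in\mathbb{R}^n$ of the cubic model $$m_k(s)=\langle \nabla f(x_k),s\rangle+\tfrac12\langle \nabla^2 f(x_k)s,s\rangle+\tfrac{M}{6}\|s\|^3 .$$ Then for every $\varepsilon>0$, $$\min_{1\le i\le K}\|\nabla f(x_i)\|\le\varepsilon\qquad\text{for}\qquad K=\left\lceil \frac{12\,(f(x_0)-f^\star)}{M}\Bigl(\frac{L_H+M}{2}\Bigr)^{3/2}\varepsilon^{-3/2}\right\rceil,$$ where the quantity inside the ceiling is $\mathcal{O}\bigl(\sqrt{M}\,(f(x_0)-f^\star)\,\varepsilon^{-3/2}\bigr)$ with an absolute constant. Moreover, with the choice $M=2L_H$ (when $L_H>0$), $$K\le\bigl\lceil 6\,(3/2)^{3/2}\sqrt{L_H}\,(f(x_0)-f^\star)\,\varepsilon^{-3/2}\bigr\rceil\le\bigl\lceil 12\sqrt{L_H}\,(f(x_0)-f^\star)\,\varepsilon^{-3/2}\bigr\rceil .$$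
   Context: Norms are the Euclidean norm for vectors and the induced operator (spectral) norm for matrices. *)

theory Defs
  imports "HOL-Analysis.Analysis"
begin

definition gradient :: "(real^'n \<Rightarrow> real) \<Rightarrow> real^'n \<Rightarrow> real^'n" where
  "gradient f x = (THE g. GDERIV f x :> g)"

definition hessian :: "(real^'n \<Rightarrow> real) \<Rightarrow> real^'n \<Rightarrow> real^'n^'n" where
  "hessian f x = jacobian (gradient f) (at x)"

definition twice_differentiable :: "(real^'n \<Rightarrow> real) \<Rightarrow> bool" where
  "twice_differentiable f \<longleftrightarrow>
     (\<forall>x. f differentiable (at x)) \<and> (\<forall>x. gradient f differentiable (at x))"

(* The library norm on real^'n^'n is the Frobenius norm, so the spectral norm
   is written as the operator norm of the associated linear map. *)
definition lipschitz_hessian :: "real \<Rightarrow> (real^'n \<Rightarrow> real) \<Rightarrow> bool" where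
  "lipschitz_hessian L f \<longleftrightarrow>
     (\<forall>x y. onorm ((*v) (hessian f x - hessian f y)) \<le> L * norm (x - y))"

definition cubic_model :: "(real^'n \<Rightarrow> real) \<Rightarrow> real \<Rightarrow> real^'n \<Rightarrow> real^'n \<Rightarrow> real" where
  "cubic_model f M x s =
     gradient f x \<bullet> s + 1/2 * ((hessian f x *v s) \<bullet> s) + M/6 * norm s ^ 3"

(* The quantity inside the ceiling; Delta stands for f(x_0) - inf f. *)
definition cubic_bound :: "real \<Rightarrow> real \<Rightarrow> real \<Rightarrow> real \<Rightarrow> real" where
  "cubic_bound L M \<Delta> \<epsilon> = 12 * \<Delta> / M * ((L + M) / 2) powr (3/2) * \<epsilon> powr (-3/2)"

lemma gradient_eqI:
  assumes "GDERIV f x :> g"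
  shows "gradient f x = g"
  unfolding gradient_def
proof (rule the_equality[where P = "\<lambda>g. GDERIV f x :> g", OF assms])
  fix g' assume "GDERIV f x :> g'"
  with assms have "(\<lambda>h. h \<bullet> g) = (\<lambda>h. h \<bullet> g')"
    unfolding gderiv_def by (rule has_derivative_unique)
  then have "\<forall>h. h \<bullet> g = h \<bullet> g'"
    by (simp add: fun_eq_iff)
  then have "g = g'"
    by (simp only: vector_eq_ldot)
  then show "g' = g" ..
qed

lemma GDERIV_gradient:
  assumes "f differentiable (at x)"
  shows "GDERIV f x :> gradient f x"
proof -
  obtain f' where f': "(f has_derivative f') (at x)"
    using assms by (auto simp: differentiable_def)
  then interpret bounded_linear f' by (rule has_derivative_bounded_linear)
  have eq: "f' = (\<lambda>h. h \<bullet> adjoint f' 1)"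
    using adjoint_works[OF linear_axioms, where y = "1::real"] by (intro ext) simp
  have g: "GDERIV f x :> adjoint f' 1"
    unfolding gderiv_def by (rule has_derivative_eq_rhs[OF f' eq])
  show ?thesis
    unfolding gradient_eqI[OF g] by (rule g)
qed

end

theory Submission
  imports Defs
begin

text \<open>Comparing the cubic model at \<open>s\<close> and \<open>-s\<close> shows that a global minimizer satisfies
  \<open>\<langle>g, s\<rangle> \<le> 0\<close>; with the stationarity condition \<open>g + H s + (M/2) \<parallel>s\<parallel> s = 0\<close> this gives
  \<open>m(s) \<le> - (M/12) \<parallel>s\<parallel>\<^sup>3\<close>, and hence the decrease of \<open>f\<close> by at least \<open>(M/12) \<parallel>s\<parallel>\<^sup>3\<close>
  in each step. Stationarity also bounds the next gradient by \<open>((L + M)/2) \<parallel>s\<parallel>\<^sup>2\<close>, so as long as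
  the gradients exceed \<open>\<epsilon>\<close> every step costs a fixed amount of \<open>f\<close>. The stationarity condition
  needs the Hessian to be symmetric, which follows from comparing two expansions of the mixed
  second difference of \<open>f\<close>.\<close>

section \<open>Derivatives along lines and Taylor estimates\<close>

lemma has_derivative_gradient:
  assumes "twice_differentiable f"
  shows "(f has_derivative (\<lambda>h. h \<bullet> gradient f x)) (at x)"
  using GDERIV_gradient[of f x] assms unfolding twice_differentiable_def gderiv_def by simp

lemma gradient_has_derivative_hessian:
  assumes "twice_differentiable f"
  shows "(gradient f has_derivative (\<lambda>h. hessian f x *v h)) (at x)"
  using assms unfolding twice_differentiable_def hessian_def
  by (simp flip: jacobian_works)

lemma has_real_derivative_along_line:
  assumes "twice_differentiable f"
  shows "((\<lambda>t. f (a + t *\<^sub>R v)) has_real_derivative gradient f (a + t *\<^sub>R v) \<bullet> v) (at t within S)"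
proof -
  have "((\<lambda>t. f (a + t *\<^sub>R v)) has_derivative (\<lambda>h. (h *\<^sub>R v) \<bullet> gradient f (a + t *\<^sub>R v))) (at t within S)"
    by (rule has_derivative_compose[OF _ has_derivative_gradient[OF assms]])
      (auto intro!: derivative_eq_intros)
  then show ?thesis
    unfolding has_field_derivative_def
    by (rule has_derivative_eq_rhs) (auto simp: inner_commute)
qed

text \<open>The Lipschitz condition bounds the derivative of the remainder along the segment by
  \<open>L * t * norm h ^ 2\<close>; the mean value inequality turns this into the factor
  \<open>L / 2\<close>.\<close>

lemma gradient_taylor_bound:
  assumes td: "twice_differentiable f" and lip: "lipschitz_hessian L f"
  shows "norm (gradient f (x + h) - gradient f x - hessian f x *v h) \<le> L / 2 * norm h ^ 2"
proof -
  define F where "F = (\<lambda>t. gradient f (x + t *\<^sub>R h) - t *\<^sub>R (hessian f x *v h))"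
  have F: "(F has_vector_derivative (hessian f (x + t *\<^sub>R h) - hessian f x) *v h) (at t within S)"
    for t S
  proof -
    have "((\<lambda>t. gradient f (x + t *\<^sub>R h)) has_derivative (\<lambda>u. hessian f (x + t *\<^sub>R h) *v (u *\<^sub>R h)))
        (at t within S)"
      by (rule has_derivative_compose[OF _ gradient_has_derivative_hessian[OF td]])
        (auto intro!: derivative_eq_intros)
    then show ?thesis
      unfolding F_def has_vector_derivative_def
      by (auto intro!: derivative_eq_intros
          simp: matrix_vector_mult_diff_rdistrib algebra_simps matrix_vector_mult_scaleR)
  qed
  have bound: "norm ((hessian f (x + t *\<^sub>R h) - hessian f x) *v h) \<le> L * t * norm h ^ 2"
    if "0 < t" for t
  proof -
    have "norm ((hessian f (x + t *\<^sub>R h) - hessian f x) *v h)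
        \<le> onorm ((*v) (hessian f (x + t *\<^sub>R h) - hessian f x)) * norm h"
      by (rule onorm) (rule matrix_vector_mul_bounded_linear)
    also have "\<dots> \<le> (L * norm (t *\<^sub>R h)) * norm h"
      using lip[unfolded lipschitz_hessian_def, rule_format, of "x + t *\<^sub>R h" x]
      by (intro mult_right_mono) auto
    finally show ?thesis
      using that by (simp add: power2_eq_square mult_ac)
  qed
  \<comment> \<open>The factors \<open>1\<^sup>2\<close> and \<open>0\<^sup>2\<close> stay
    unsimplified so that the right side has the form \<open>\<phi> 1 - \<phi> 0\<close> of the
    rule.\<close>
  have "norm (F 1 - F 0) \<le> L / 2 * 1\<^sup>2 * norm h ^ 2 - L / 2 * 0\<^sup>2 * norm h ^ 2"
  proof (rule differentiable_bound_general[where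
        f' = "\<lambda>t. (hessian f (x + t *\<^sub>R h) - hessian f x) *v h"
        and \<phi>' = "\<lambda>t. L * t * norm h ^ 2"])
    show "continuous_on {0..1} F"
      by (meson F continuous_on_vector_derivative)
    show "continuous_on {0..1::real} (\<lambda>t. L / 2 * t\<^sup>2 * norm h ^ 2)"
      by (intro continuous_intros)
  next
    fix t :: real
    show "((\<lambda>t. L / 2 * t\<^sup>2 * norm h ^ 2) has_vector_derivative L * t * norm h ^ 2) (at t)"
      unfolding has_real_derivative_iff_has_vector_derivative[symmetric]
      by (auto intro!: derivative_eq_intros)
  qed (use F bound in auto)
  then show ?thesis
    by (simp add: F_def algebra_simps)
qed

text \<open>\<open>G\<close> is the Taylor error along the segment minus the cubic allowance. The
  gradient estimate makes its derivative nonpositive, since \<open>L / 6 * t ^ 3\<close> has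
  derivative \<open>L / 2 * t\<^sup>2\<close>.\<close>

lemma function_taylor_upper_bound:
  assumes td: "twice_differentiable f" and lip: "lipschitz_hessian L f"
  shows "f (x + h) \<le> f x + gradient f x \<bullet> h + 1/2 * ((hessian f x *v h) \<bullet> h) + L / 6 * norm h ^ 3"
proof -
  define G where "G = (\<lambda>t. f (x + t *\<^sub>R h) - t * (gradient f x \<bullet> h)
    - t\<^sup>2 / 2 * ((hessian f x *v h) \<bullet> h) - L / 6 * t ^ 3 * norm h ^ 3)"
  have "G 1 \<le> G 0"
  proof (rule DERIV_nonpos_imp_nonincreasing[where f = G])
    fix t :: real assume t: "0 \<le> t" "t \<le> 1"
    let ?r = "gradient f (x + t *\<^sub>R h) - gradient f x - hessian f x *v (t *\<^sub>R h)"
    have "(G has_real_derivative ?r \<bullet> h - L / 2 * t\<^sup>2 * norm h ^ 3) (at t)"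
      unfolding G_def
      by (auto intro!: derivative_eq_intros has_real_derivative_along_line[OF td]
          simp: inner_diff_left matrix_vector_mult_scaleR)
    moreover have "?r \<bullet> h \<le> norm ?r * norm h"
      by (rule norm_cauchy_schwarz)
    moreover have "norm ?r * norm h \<le> (L / 2 * norm (t *\<^sub>R h) ^ 2) * norm h"
      by (intro mult_right_mono gradient_taylor_bound[OF td lip]) auto
    moreover have "(L / 2 * norm (t *\<^sub>R h) ^ 2) * norm h = L / 2 * t\<^sup>2 * norm h ^ 3"
      using t by (simp add: power2_eq_square power3_eq_cube)
    ultimately show "\<exists>y. (G has_real_derivative y) (at t) \<and> y \<le> 0"
      by (intro exI conjI) (assumption, linarith)
  qed simp
  then show ?thesis
    by (simp add: G_def)
qed

section \<open>Symmetry of the Hessian\<close>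

text \<open>The mean value theorem in direction \<open>v\<close> leaves a difference of two
  gradients, and expanding both about \<open>x\<close> costs an error of order
  \<open>t\<^sup>2\<close>. With the outer factor \<open>t\<close> this makes order
  \<open>t ^ 3\<close>.\<close>

lemma second_difference_bound:
  assumes td: "twice_differentiable f" and lip: "lipschitz_hessian L f" and L: "0 \<le> L" and t: "0 < t"
  shows "\<bar>f (x + t *\<^sub>R u + t *\<^sub>R v) - f (x + t *\<^sub>R v) - f (x + t *\<^sub>R u) + f x - t\<^sup>2 * ((hessian f x *v u) \<bullet> v)\<bar>
    \<le> t ^ 3 * (L * (norm u + norm v) ^ 2 * norm v)"
proof -
  define R where "R = (\<lambda>h. gradient f (x + h) - gradient f x - hessian f x *v h)"
  have R: "norm (R h) \<le> L / 2 * (t * (norm u + norm v)) ^ 2" if "norm h \<le> t * (norm u + norm v)" for h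
  proof -
    have "norm (R h) \<le> L / 2 * norm h ^ 2"
      unfolding R_def by (rule gradient_taylor_bound[OF td lip])
    also have "\<dots> \<le> L / 2 * (t * (norm u + norm v)) ^ 2"
      using L that by (intro mult_left_mono power_mono) auto
    finally show ?thesis .
  qed
  let ?q = "\<lambda>\<tau>. f ((x + t *\<^sub>R u) + \<tau> *\<^sub>R v) - f (x + \<tau> *\<^sub>R v)"
  have "\<exists>z. 0 < z \<and> z < t \<and> ?q t - ?q 0 =
      (t - 0) * (gradient f ((x + t *\<^sub>R u) + z *\<^sub>R v) \<bullet> v - gradient f (x + z *\<^sub>R v) \<bullet> v)"
    using t by (intro MVT2) (auto intro!: derivative_eq_intros has_real_derivative_along_line[OF td])
  then obtain z where z: "0 < z" "z < t" and q: "?q t - ?q 0 =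
      t * (gradient f ((x + t *\<^sub>R u) + z *\<^sub>R v) \<bullet> v - gradient f (x + z *\<^sub>R v) \<bullet> v)"
    by auto
  let ?d = "R (t *\<^sub>R u + z *\<^sub>R v) - R (z *\<^sub>R v)"
  have zv: "norm (z *\<^sub>R v) \<le> t * norm v"
    using z by (simp add: mult_right_mono)
  have "norm (t *\<^sub>R u + z *\<^sub>R v) \<le> norm (t *\<^sub>R u) + norm (z *\<^sub>R v)"
    by (rule norm_triangle_ineq)
  also have "\<dots> \<le> t * (norm u + norm v)"
    using zv t by (simp add: algebra_simps)
  finally have 1: "norm (R (t *\<^sub>R u + z *\<^sub>R v)) \<le> L / 2 * (t * (norm u + norm v)) ^ 2"
    by (rule R)
  have "norm (z *\<^sub>R v) \<le> t * (norm u + norm v)"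
    unfolding distrib_left using zv t by (intro add_increasing) auto
  then have 2: "norm (R (z *\<^sub>R v)) \<le> L / 2 * (t * (norm u + norm v)) ^ 2"
    by (rule R)
  have "norm ?d \<le> L * (t * (norm u + norm v)) ^ 2"
    using norm_triangle_ineq4[of "R (t *\<^sub>R u + z *\<^sub>R v)" "R (z *\<^sub>R v)"] 1 2 by simp
  then have "\<bar>?d \<bullet> v\<bar> \<le> (L * (t * (norm u + norm v)) ^ 2) * norm v"
    by (meson Cauchy_Schwarz_ineq2 mult_right_mono norm_ge_zero order_trans)
  then have "t * \<bar>?d \<bullet> v\<bar> \<le> t * ((L * (t * (norm u + norm v)) ^ 2) * norm v)"
    using t by (intro mult_left_mono) auto
  also have "\<dots> = t ^ 3 * (L * (norm u + norm v) ^ 2 * norm v)"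
    by (simp add: power2_eq_square power3_eq_cube)
  finally have d: "t * \<bar>?d \<bullet> v\<bar> \<le> \<dots>" .
  \<comment> \<open>The terms \<open>gradient f x\<close> and
    \<open>hessian f x *v (z *\<^sub>R v)\<close> occur in both expansions and cancel, so the
    unknown \<open>z\<close> survives only inside the remainders.\<close>
  have "f (x + t *\<^sub>R u + t *\<^sub>R v) - f (x + t *\<^sub>R v) - f (x + t *\<^sub>R u) + f x - t\<^sup>2 * ((hessian f x *v u) \<bullet> v)
      = t * (?d \<bullet> v)"
    using q by (simp add: R_def algebra_simps inner_diff_left inner_add_left power2_eq_square
        matrix_vector_right_distrib matrix_vector_mult_scaleR)
  then show ?thesis
    using d t by (simp add: abs_mult)
qed

text \<open>The second difference is unchanged when \<open>u\<close> and \<open>v\<close> are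
  exchanged, so both products scaled by \<open>t\<^sup>2\<close> lie within order
  \<open>t ^ 3\<close> of it. Divide by \<open>t\<^sup>2\<close> and let \<open>t\<close> tend to
  0.\<close>

lemma hessian_symmetric:
  assumes td: "twice_differentiable f" and lip: "lipschitz_hessian L f" and L: "0 \<le> L"
  shows "(hessian f x *v u) \<bullet> v = (hessian f x *v v) \<bullet> u"
proof -
  let ?A = "(hessian f x *v u) \<bullet> v" and ?B = "(hessian f x *v v) \<bullet> u"
  define C where "C = L * (norm u + norm v) ^ 2 * norm v + L * (norm v + norm u) ^ 2 * norm u"
  have bound: "\<bar>?A - ?B\<bar> \<le> t * C" if "0 < t" for t
  proof -
    let ?D = "f (x + t *\<^sub>R u + t *\<^sub>R v) - f (x + t *\<^sub>R v) - f (x + t *\<^sub>R u) + f x"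
    have "\<bar>?D - t\<^sup>2 * ?A\<bar> \<le> t ^ 3 * (L * (norm u + norm v) ^ 2 * norm v)"
      by (rule second_difference_bound[OF td lip L that])
    moreover have "\<bar>?D - t\<^sup>2 * ?B\<bar> \<le> t ^ 3 * (L * (norm v + norm u) ^ 2 * norm u)"
      using second_difference_bound[OF td lip L that, of x v u] by (simp add: algebra_simps)
    ultimately have "\<bar>t\<^sup>2 * ?A - t\<^sup>2 * ?B\<bar> \<le> t ^ 3 * C"
      unfolding C_def distrib_left[of "t ^ 3"] by linarith
    then have "t\<^sup>2 * \<bar>?A - ?B\<bar> \<le> t\<^sup>2 * (t * C)"
      by (simp add: abs_mult right_diff_distrib[symmetric] power2_eq_square power3_eq_cube mult.assoc)
    then show ?thesis
      using that by simp
  qed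
  have "((\<lambda>t. t * C) \<longlongrightarrow> 0) (at_right 0)"
    by (auto intro!: tendsto_eq_intros)
  then have "\<bar>?A - ?B\<bar> \<le> 0"
    by (rule tendsto_lowerbound)
      (auto simp: eventually_at_right_field intro!: exI[of _ 1] bound)
  then show ?thesis
    by simp
qed

section \<open>Minimizers of the cubic model\<close>

text \<open>The chain rule through the norm handles \<open>s \<noteq> 0\<close>; at the origin the
  difference quotient is \<open>norm h ^ 2\<close>, which tends to 0.\<close>

lemma has_derivative_norm_cube:
  fixes s :: "'a::real_inner"
  shows "((\<lambda>s. norm s ^ 3) has_derivative (\<lambda>h. 3 * norm s * (s \<bullet> h))) (at s)"
proof (cases "s = 0")
  case True
  have "((\<lambda>h::'a. norm h ^ 2) \<longlongrightarrow> 0) (at 0)"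
    by (auto intro!: tendsto_eq_intros)
  moreover have "norm h ^ 3 / norm h = norm h ^ 2" for h :: 'a
    by (simp add: power2_eq_square power3_eq_cube)
  ultimately show ?thesis
    using True by (simp add: has_derivative_at bounded_linear_zero)
next
  case False
  then show ?thesis
    by (auto intro!: derivative_eq_intros has_derivative_norm
        simp: fun_eq_iff sgn_div_norm inner_commute power2_eq_square divide_simps)
qed

lemma cubic_model_minimizer_stationary:
  fixes f :: "real^'n \<Rightarrow> real"
  assumes sym: "\<And>u v. (hessian f x *v u) \<bullet> v = (hessian f x *v v) \<bullet> u"
    and min: "is_arg_min (cubic_model f M x) (\<lambda>_. True) s"
  shows "gradient f x + hessian f x *v s + (M / 2 * norm s) *\<^sub>R s = 0"
proof -
  let ?g = "gradient f x + hessian f x *v s + (M / 2 * norm s) *\<^sub>R s"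
  have "(cubic_model f M x has_derivative (\<lambda>h. gradient f x \<bullet> h
      + 1/2 * ((hessian f x *v s) \<bullet> h + (hessian f x *v h) \<bullet> s) + M/6 * (3 * norm s * (s \<bullet> h)))) (at s)"
    unfolding cubic_model_def
    by (rule derivative_eq_intros refl has_derivative_norm_cube
        bounded_linear_imp_has_derivative[OF matrix_vector_mul_bounded_linear])+
       (auto simp: inner_commute)
  \<comment> \<open>Symmetry merges the two halves of the derivative of the quadratic term into one
    linear form in \<open>h\<close>.\<close>
  then have "(cubic_model f M x has_derivative (\<lambda>h. ?g \<bullet> h)) (at s)"
    by (rule has_derivative_eq_rhs) (auto simp: sym[of _ s] inner_add_left)
  then have "(\<lambda>h. ?g \<bullet> h) = (\<lambda>h. 0)"
    using min by (intro differential_zero_maxmin[of s UNIV]) (auto simp: is_arg_min_linorder)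
  then have "?g \<bullet> ?g = 0"
    by meson
  then show ?thesis
    by simp
qed

lemma cubic_model_minimizer_le:
  fixes f :: "real^'n \<Rightarrow> real"
  assumes sym: "\<And>u v. (hessian f x *v u) \<bullet> v = (hessian f x *v v) \<bullet> u"
    and min: "is_arg_min (cubic_model f M x) (\<lambda>_. True) s"
  shows "cubic_model f M x s \<le> - (M / 12) * norm s ^ 3"
proof -
  have "(gradient f x + hessian f x *v s + (M / 2 * norm s) *\<^sub>R s) \<bullet> s = 0"
    using cubic_model_minimizer_stationary[OF assms] by simp
  then have "gradient f x \<bullet> s + (hessian f x *v s) \<bullet> s + M / 2 * norm s ^ 3 = 0"
    by (simp add: inner_add_left power3_eq_cube dot_square_norm power2_eq_square)
  \<comment> \<open>Only the linear term changes sign under \<open>s \<mapsto> - s\<close>.\<close>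
  moreover have "cubic_model f M x s \<le> cubic_model f M x (- s)"
    using min by (simp add: is_arg_min_linorder)
  then have "gradient f x \<bullet> s \<le> 0"
    by (simp add: cubic_model_def linear_neg[OF matrix_vector_mul_linear])
  \<comment> \<open>Substituting half of the stationarity identity leaves half of
    \<open>gradient f x \<bullet> s\<close> plus \<open>(M/6 - M/4) * norm s ^ 3\<close>, whence the
    constant \<open>M / 12\<close>.\<close>
  ultimately show ?thesis
    unfolding cubic_model_def by linarith
qed

section \<open>Progress made by a single step\<close>

lemma cubic_newton_step:
  fixes f :: "real^'n \<Rightarrow> real"
  assumes td: "twice_differentiable f" and lip: "lipschitz_hessian L f" and L: "0 \<le> L" "L \<le> M"
    and min: "is_arg_min (cubic_model f M x) (\<lambda>_. True) s"
  shows "f (x + s) \<le> f x - M / 12 * norm s ^ 3"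
    and "norm (gradient f (x + s)) \<le> (L + M) / 2 * norm s ^ 2"
proof -
  note sym = hessian_symmetric[OF td lip L(1)]
  \<comment> \<open>Since \<open>L \<le> M\<close>, the model shifted by \<open>f x\<close>
    majorizes \<open>f (x + s)\<close>.\<close>
  have "L / 6 * norm s ^ 3 \<le> M / 6 * norm s ^ 3"
    using L by (intro mult_right_mono) auto
  then show "f (x + s) \<le> f x - M / 12 * norm s ^ 3"
    using function_taylor_upper_bound[OF td lip, of x s] cubic_model_minimizer_le[OF sym min]
    unfolding cubic_model_def by linarith
  have "gradient f x + hessian f x *v s = - ((M / 2 * norm s) *\<^sub>R s)"
    using cubic_model_minimizer_stationary[OF sym min] by (simp add: eq_neg_iff_add_eq_0)
  then have *: "norm (gradient f x + hessian f x *v s) = M / 2 * norm s ^ 2"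
    using L by (simp add: power2_eq_square)
  \<comment> \<open>The Taylor remainder contributes \<open>L / 2\<close>, the stationarity
    condition \<open>M / 2\<close>.\<close>
  have "norm (gradient f (x + s)) \<le> norm (gradient f (x + s) - gradient f x - hessian f x *v s)
      + norm (gradient f x + hessian f x *v s)"
    by (rule norm_triangle_sub[of "gradient f (x + s)" "gradient f x + hessian f x *v s",
          THEN order_trans]) (simp add: algebra_simps)
  then show "norm (gradient f (x + s)) \<le> (L + M) / 2 * norm s ^ 2"
    using gradient_taylor_bound[OF td lip, of x s] * by (simp add: field_simps)
qed

lemma gradient_eq_0_at_minimum:
  assumes td: "twice_differentiable f" and min: "\<And>y. f x \<le> f y"
  shows "gradient f x = 0"
proof -
  have "(\<lambda>h. h \<bullet> gradient f x) = (\<lambda>h. 0)"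
    using min by (intro differential_zero_maxmin[of x UNIV f, OF _ _ has_derivative_gradient[OF td]]) auto
  then have "gradient f x \<bullet> gradient f x = 0"
    by meson
  then show ?thesis
    by simp
qed

text \<open>The power 3/2 converts the quadratic gradient bound into \<open>norm s ^ 3\<close>, the
  unit in which the decrease of \<open>f\<close> is measured.\<close>

lemma cubic_newton_step_cost:
  fixes f :: "real^'n \<Rightarrow> real"
  assumes step: "norm (gradient f (x + s)) \<le> c * norm s ^ 2"
    and c: "0 < c" and \<epsilon>: "0 < \<epsilon>" "\<epsilon> < norm (gradient f (x + s))"
  shows "\<epsilon> powr (3/2) / c powr (3/2) < norm s ^ 3"
proof -
  have "\<epsilon> / c < norm s ^ 2"
    using assms by (simp add: field_simps)
  then have "(\<epsilon> / c) powr (3/2) < (norm s ^ 2) powr (3/2)"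
    using c \<epsilon> by (intro powr_less_mono2) auto
  moreover have "norm s \<noteq> 0"
    using step \<epsilon> by auto
  then have "(norm s ^ 2) powr (3/2) = norm s ^ 3"
    by (simp add: powr_powr flip: powr_numeral)
  ultimately show ?thesis
    using c \<epsilon> by (simp add: powr_divide)
qed

section \<open>Counting the steps\<close>

lemma cubic_newton_min_gradient_le:
  fixes f :: "real^'n \<Rightarrow> real"
  assumes td: "twice_differentiable f" and lip: "lipschitz_hessian L f" and L: "0 \<le> L" "L \<le> M"
    and M: "0 < M" and lower: "\<And>y. f\<^sub>0 \<le> f y" and \<Delta>: "f\<^sub>0 < f (x 0)"
    and min: "\<And>k. is_arg_min (cubic_model f M (x k)) (\<lambda>_. True) (s k)"
    and x: "\<And>k. x (Suc k) = x k + s k" and \<epsilon>: "0 < \<epsilon>"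
  shows "(MIN i\<in>{1..nat \<lceil>cubic_bound L M (f (x 0) - f\<^sub>0) \<epsilon>\<rceil>}. norm (gradient f (x i))) \<le> \<epsilon>"
proof (rule ccontr)
  let ?B = "cubic_bound L M (f (x 0) - f\<^sub>0) \<epsilon>"
  define K where "K = nat \<lceil>?B\<rceil>"
  define c where "c = (L + M) / 2"
  define d where "d = \<epsilon> powr (3/2) / c powr (3/2)"
  have c: "0 < c"
    using L M by (simp add: c_def)
  have d: "0 < d"
    using c \<epsilon> by (simp add: d_def)
  \<comment> \<open>In this form \<open>?B\<close> is the initial gap divided by the guaranteed
    decrease \<open>M / 12 * d\<close> per step.\<close>
  have B: "?B = 12 * (f (x 0) - f\<^sub>0) / M / d"
    using powr_minus[of \<epsilon> "3/2"] by (simp add: cubic_bound_def d_def c_def field_simps)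
  \<comment> \<open>The strict gap makes the index set \<open>{1..K}\<close> nonempty, so that
    \<open>MIN\<close> is a genuine minimum.\<close>
  then have "0 < ?B"
    using \<Delta> M d by simp
  then have K: "0 < K" "?B \<le> real K"
    unfolding K_def by linarith+
  assume "\<not> ?thesis"
  then have big: "\<epsilon> < norm (gradient f (x i))" if "i \<in> {1..K}" for i
    using that K(1) by (auto simp: K_def[symmetric] not_le)
  \<comment> \<open>Step \<open>k\<close> is controlled by the gradient at the next iterate, so
    \<open>k < K\<close> matches the indices \<open>1\<close> to \<open>K\<close>.\<close>
  have decrease: "f (x (Suc k)) < f (x k) - M / 12 * d" if "k < K" for k
  proof -
    have "d < norm (s k) ^ 3"
      unfolding d_def
    proof (rule cubic_newton_step_cost)
      show "norm (gradient f (x k + s k)) \<le> c * norm (s k) ^ 2"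
        unfolding c_def by (rule cubic_newton_step(2)[OF td lip L min])
      show "\<epsilon> < norm (gradient f (x k + s k))"
        using big[of "Suc k"] that x by simp
    qed (use c \<epsilon> in auto)
    then have "M / 12 * d < M / 12 * norm (s k) ^ 3"
      using M by simp
    then show ?thesis
      using cubic_newton_step(1)[OF td lip L min, of k] x by simp
  qed
  have "f (x k) \<le> f (x 0) - real k * (M / 12 * d)" if "k \<le> K" for k
    using that
  proof (induction k)
    case (Suc k)
    then show ?case
      using decrease[of k] by (simp add: add_divide_distrib algebra_simps)
  qed simp
  \<comment> \<open>The induction yields only a weak inequality; splitting off the last step makes
    it strict, which is essential when \<open>?B\<close> equals \<open>K\<close>.\<close>
  from this[of "K - 1"] have "f (x (K - 1)) \<le> f (x 0) - real (K - 1) * (M / 12 * d)"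
    by simp
  moreover have "f (x K) < f (x (K - 1)) - M / 12 * d"
    using decrease[of "K - 1"] K(1) by simp
  ultimately have "f (x K) < f (x 0) - real K * (M / 12 * d)"
    using K(1) by (simp add: of_nat_diff diff_divide_distrib algebra_simps)
  moreover have "?B * (M / 12 * d) \<le> real K * (M / 12 * d)"
    using K(2) M d by (intro mult_right_mono) auto
  moreover have "?B * (M / 12 * d) = f (x 0) - f\<^sub>0"
    unfolding B using M d by simp
  ultimately show False
    using lower[of "x K"] by linarith
qed

section \<open>Size of the iteration bound\<close>

lemma powr_three_halves:
  "a powr (3/2) = a * sqrt a" if "0 \<le> a" for a :: real
proof -
  have "a powr (3/2) = a powr (1 + 1/2)"
    by simp
  also have "\<dots> = a powr 1 * a powr (1/2)"
    by (rule powr_add)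
  finally show ?thesis
    using that by (simp add: powr_half_sqrt)
qed

text \<open>From \<open>L \<le> M\<close> the mean \<open>(L + M) / 2\<close> is at most
  \<open>M\<close>, and \<open>M * sqrt M\<close> divided by \<open>M\<close> leaves
  \<open>sqrt M\<close>.\<close>

lemma cubic_bound_abs_le:
  assumes "0 \<le> L" "L \<le> M" "0 < M" "0 \<le> \<Delta>"
  shows "\<bar>cubic_bound L M \<Delta> \<epsilon>\<bar> \<le> 12 * (sqrt M * \<Delta> * \<epsilon> powr (-3/2))"
proof -
  have "((L + M) / 2) powr (3/2) \<le> M * sqrt M"
    using assms by (subst powr_three_halves[symmetric]) (auto intro!: powr_mono2)
  then have "12 * \<Delta> / M * ((L + M) / 2) powr (3/2) * \<epsilon> powr (-3/2)
      \<le> 12 * \<Delta> / M * (M * sqrt M) * \<epsilon> powr (-3/2)"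
    using assms by (intro mult_right_mono mult_left_mono) auto
  moreover have "0 \<le> cubic_bound L M \<Delta> \<epsilon>"
    using assms by (simp add: cubic_bound_def)
  ultimately show ?thesis
    using assms by (simp add: cubic_bound_def mult_ac)
qed

lemma cubic_bound_double:
  assumes "0 < L"
  shows "cubic_bound L (2 * L) \<Delta> \<epsilon> = 6 * (3/2) powr (3/2) * sqrt L * \<Delta> * \<epsilon> powr (-3/2)"
proof -
  have "((L + 2 * L) / 2) powr (3/2) = (3/2 * L) powr (3/2)"
    by simp
  also have "\<dots> = (3/2) powr (3/2) * (L * sqrt L)"
    using assms by (subst powr_mult) (simp_all add: powr_three_halves)
  finally show ?thesis
    using assms by (simp add: cubic_bound_def)
qed

lemma three_halves_powr_le: "(3/2) powr (3/2) \<le> (2::real)"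
proof -
  \<comment> \<open>The value \<open>4/3\<close> is what makes \<open>3/2 * sqrt (3/2)\<close> at
    most 2.\<close>
  have "sqrt (3/2) \<le> 4/3"
    by (rule real_le_lsqrt) (auto simp: power2_eq_square)
  then show ?thesis
    by (simp add: powr_three_halves)
qed

theorem theorem3p10:
  fixes f :: "real^'n \<Rightarrow> real"
    and x s :: "nat \<Rightarrow> real^'n"
    and L\<^sub>H M f\<^sub>0 :: real
  assumes "twice_differentiable f"
    and "0 \<le> L\<^sub>H"
    and "lipschitz_hessian L\<^sub>H f"
    and "bdd_below (range f)"
    and "f\<^sub>0 = Inf (range f)"
    and "0 < M"
    and "L\<^sub>H \<le> M"
    and "gradient f (x 0) \<noteq> 0"
    and "\<And>k. is_arg_min (cubic_model f M (x k)) (\<lambda>_. True) (s k)"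
    and "\<And>k. x (Suc k) = x k + s k"
  shows "(\<forall>\<epsilon>>0. (MIN i\<in>{1..nat \<lceil>cubic_bound L\<^sub>H M (f (x 0) - f\<^sub>0) \<epsilon>\<rceil>}. norm (gradient f (x i))) \<le> \<epsilon>)
    \<and> (\<exists>C>0. \<forall>L' M' \<Delta> \<epsilon>. 0 \<le> L' \<and> L' \<le> M' \<and> 0 < M' \<and> 0 \<le> \<Delta> \<and> 0 < \<epsilon> \<longrightarrow>
           \<bar>cubic_bound L' M' \<Delta> \<epsilon>\<bar> \<le> C * (sqrt M' * \<Delta> * \<epsilon> powr (-3/2)))
    \<and> (0 < L\<^sub>H \<and> M = 2 * L\<^sub>H \<longrightarrow> (\<forall>\<epsilon>>0.
           \<lceil>cubic_bound L\<^sub>H M (f (x 0) - f\<^sub>0) \<epsilon>\<rceil>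
             \<le> \<lceil>6 * (3/2) powr (3/2) * sqrt L\<^sub>H * (f (x 0) - f\<^sub>0) * \<epsilon> powr (-3/2)\<rceil> \<and>
           \<lceil>6 * (3/2) powr (3/2) * sqrt L\<^sub>H * (f (x 0) - f\<^sub>0) * \<epsilon> powr (-3/2)\<rceil>
             \<le> \<lceil>12 * sqrt L\<^sub>H * (f (x 0) - f\<^sub>0) * \<epsilon> powr (-3/2)\<rceil>))"
proof (intro conjI impI allI)
  have lower: "f\<^sub>0 \<le> f y" for y
    using assms(4,5) by (auto intro: cInf_lower)
  \<comment> \<open>If the gap vanished, \<open>x 0\<close> would be a global minimizer and its
    gradient zero.\<close>
  have \<Delta>: "f\<^sub>0 < f (x 0)"
  proof (rule ccontr)
    assume "\<not> f\<^sub>0 < f (x 0)"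
    then have "gradient f (x 0) = 0"
      using lower by (intro gradient_eq_0_at_minimum[OF assms(1)]) (meson not_less order_trans)
    then show False
      using assms(8) by simp
  qed
  show "(MIN i\<in>{1..nat \<lceil>cubic_bound L\<^sub>H M (f (x 0) - f\<^sub>0) \<epsilon>\<rceil>}. norm (gradient f (x i))) \<le> \<epsilon>"
    if "0 < \<epsilon>" for \<epsilon>
    by (rule cubic_newton_min_gradient_le[OF assms(1,3,2,7,6) lower \<Delta> assms(9,10) that])
  show "\<exists>C>0. \<forall>L' M' \<Delta> \<epsilon>. 0 \<le> L' \<and> L' \<le> M' \<and> 0 < M' \<and> 0 \<le> \<Delta> \<and> 0 < \<epsilon> \<longrightarrow>
      \<bar>cubic_bound L' M' \<Delta> \<epsilon>\<bar> \<le> C * (sqrt M' * \<Delta> * \<epsilon> powr (-3/2))"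
    by (intro exI[of _ 12]) (use cubic_bound_abs_le in auto)
  fix \<epsilon> :: real
  assume L: "0 < L\<^sub>H \<and> M = 2 * L\<^sub>H"
  \<comment> \<open>For \<open>M = 2 * L\<^sub>H\<close> the two arguments of the ceiling
    coincide.\<close>
  then show "\<lceil>cubic_bound L\<^sub>H M (f (x 0) - f\<^sub>0) \<epsilon>\<rceil>
      \<le> \<lceil>6 * (3/2) powr (3/2) * sqrt L\<^sub>H * (f (x 0) - f\<^sub>0) * \<epsilon> powr (-3/2)\<rceil>"
    by (simp add: cubic_bound_double)
  show "\<lceil>6 * (3/2) powr (3/2) * sqrt L\<^sub>H * (f (x 0) - f\<^sub>0) * \<epsilon> powr (-3/2)\<rceil>
      \<le> \<lceil>12 * sqrt L\<^sub>H * (f (x 0) - f\<^sub>0) * \<epsilon> powr (-3/2)\<rceil>"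
    using L \<Delta> three_halves_powr_le by (intro ceiling_mono mult_right_mono) auto
qed

end
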